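(* Let $0<\beta<1$ and $1\le\alpha<2$. Let $B_{\beta,\alpha}=\{B_{\beta,\alpha}(t),t\ge 0\}$ be a generalized grey Brownian motion, let $B^{\alpha/2}$ be a fractional Brownian motion with Hurst index $\alpha/2$, and let $Y_\beta$ be a nonnegative random variable with density $M_\beta$, independent of $B^{\alpha/2}$. Then $$\big\{B_{\beta,\alpha}(t),\,t\ge0\big\}\overset{\mathcal{L}}{=}\big\{B^{\alpha/2}(tY_\beta^{1/\alpha}),\,t\ge0\big\},$$ where $\overset{\mathcal{L}}{=}$ denotes equality in law of the processes (equality of all finite-dimensional distributions).
   Context: For $H\in[1/2,1)$, a fractional Brownian motion $B^H$ with Hurst index $H$ is a centered Gaussian process on $\mathbb{R}^+=[0,\infty)$ with continuous paths, $B^H(0)=0$ a.s., and covariance $\mathbb{E}[B^H(t)B^H(s)]=\frac12\big(t^{2H}+s^{2H}-|t-s|^{2H}\big)$ (for $H=1/2$ it is standard Brownian motion). $E_\beta(z)=\sum_{n=0}^\infty \frac{z^n}{\Gamma(\beta n+1)}$, $z\in\mathbb{C}$, is the Mittag-Leffler function. The $M$-Wright density $M_\beta$ is the probability density on $[0,\infty)$ with Laplace transform $\int_0^\infty e^{-s\tau}M_\beta(\tau)\,d\tau=E_\beta(-s)$, $s\ge0$. A generalized grey Brownian motion $B_{\beta,\alpha}$ is a continuous stochastic process with $B_{\beta,\alpha}(0)=0$ a.s. such that for all $0\le t_1<\dots<t_n<\infty$ and $\theta=(\theta_1,\dots,\theta_n)\in\mathbb{R}^n$, $$\mathbb{E}\Big[\exp\Big(i\sum_{k=1}^n\theta_kB_{\beta,\alpha}(t_k)\Big)\Big]=E_\beta\Big(-\frac12\theta^\top\Sigma_{\alpha,n}\theta\Big),\qquad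 \Sigma_{\alpha,n}=\Big(\tfrac12\big(t_k^\alpha+t_j^\alpha-|t_k-t_j|^\alpha\big)\Big)_{k,j=1}^n .$$ *)

theory Defs
  imports "HOL-Probability.Probability"
begin

text \<open>Real-valued processes indexed by $[0,\infty)$ are functions of type
  \<^typ>\<open>real \<Rightarrow> 'a \<Rightarrow> real\<close>; their values at negative times are irrelevant.\<close>

definition real_process :: "'a measure \<Rightarrow> (real \<Rightarrow> 'a \<Rightarrow> real) \<Rightarrow> bool" where
  "real_process M X \<longleftrightarrow> prob_space M \<and> (\<forall>t\<ge>0. X t \<in> borel_measurable M)"

definition continuous_process :: "'a measure \<Rightarrow> (real \<Rightarrow> 'a \<Rightarrow> real) \<Rightarrow> bool" where
  "continuous_process M X \<longleftrightarrow>
     real_process M X \<and> (\<forall>\<omega>\<in>space M. continuous_on {0..} (\<lambda>t. X t \<omega>))"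

text \<open>Point masses count as (degenerate) Gaussian laws.\<close>

definition gaussian_rv :: "'a measure \<Rightarrow> ('a \<Rightarrow> real) \<Rightarrow> bool" where
  "gaussian_rv M X \<longleftrightarrow> X \<in> borel_measurable M \<and>
     ((\<exists>\<mu> \<sigma>. 0 < \<sigma> \<and> distributed M lborel X (\<lambda>x. ennreal (normal_density \<mu> \<sigma> x))) \<or>
      (\<exists>\<mu>. AE \<omega> in M. X \<omega> = \<mu>))"

definition gaussian_process :: "'a measure \<Rightarrow> (real \<Rightarrow> 'a \<Rightarrow> real) \<Rightarrow> bool" where
  "gaussian_process M X \<longleftrightarrow> real_process M X \<and>
     (\<forall>J c. finite J \<longrightarrow> J \<subseteq> {0..} \<longrightarrow> gaussian_rv M (\<lambda>\<omega>. \<Sum>t\<in>J. c t * X t \<omega>))"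

definition fbm_cov :: "real \<Rightarrow> real \<Rightarrow> real \<Rightarrow> real" where
  "fbm_cov a t s = (t powr a + s powr a - \<bar>t - s\<bar> powr a) / 2"

definition fractional_brownian_motion ::
    "real \<Rightarrow> 'a measure \<Rightarrow> (real \<Rightarrow> 'a \<Rightarrow> real) \<Rightarrow> bool" where
  "fractional_brownian_motion H M B \<longleftrightarrow>
     gaussian_process M B \<and>
     continuous_process M B \<and>
     (AE \<omega> in M. B 0 \<omega> = 0) \<and>
     (\<forall>t\<ge>0. (\<integral>\<omega>. B t \<omega> \<partial>M) = 0) \<and>
     (\<forall>t\<ge>0. \<forall>s\<ge>0. (\<integral>\<omega>. B t \<omega> * B s \<omega> \<partial>M) = fbm_cov (2 * H) t s)"

definition mittag_leffler :: "real \<Rightarrow> complex \<Rightarrow> complex" where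
  "mittag_leffler \<beta> z = (\<Sum>n. z ^ n / complex_of_real (Gamma (\<beta> * real n + 1)))"

text \<open>The Laplace transform determines the M-Wright density only almost everywhere, so it is
  a predicate on densities: any version, extended by zero to the negative half-line, is admitted.\<close>

definition M_Wright_density :: "real \<Rightarrow> (real \<Rightarrow> real) \<Rightarrow> bool" where
  "M_Wright_density \<beta> m \<longleftrightarrow>
     m \<in> borel_measurable borel \<and>
     (\<forall>\<tau>\<ge>0. 0 \<le> m \<tau>) \<and>
     (\<forall>\<tau><0. m \<tau> = 0) \<and>
     (\<integral>\<^sup>+\<tau>. ennreal (m \<tau>) \<partial>lborel) = 1 \<and>
     (\<forall>s\<ge>0. complex_of_real (LINT \<tau>:{0..}|lborel. exp (- s * \<tau>) * m \<tau>)
             = mittag_leffler \<beta> (complex_of_real (- s)))"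

definition generalized_grey_brownian_motion ::
    "real \<Rightarrow> real \<Rightarrow> 'a measure \<Rightarrow> (real \<Rightarrow> 'a \<Rightarrow> real) \<Rightarrow> bool" where
  "generalized_grey_brownian_motion \<beta> \<alpha> M X \<longleftrightarrow>
     continuous_process M X \<and>
     (AE \<omega> in M. X 0 \<omega> = 0) \<and>
     (\<forall>(n::nat) t \<theta>. (\<forall>k\<in>{1..n}. 0 \<le> t k) \<longrightarrow> strict_mono_on {1..n} t \<longrightarrow>
        (\<integral>\<omega>. exp (\<i> * complex_of_real (\<Sum>k=1..n. \<theta> k * X (t k) \<omega>)) \<partial>M)
        = mittag_leffler \<beta> (complex_of_real
            (- (1/2) * (\<Sum>k=1..n. \<Sum>j=1..n. \<theta> k * fbm_cov \<alpha> (t k) (t j) * \<theta> j))))"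

text \<open>Independence of the $\sigma$-algebras generated by the whole process and by \<^term>\<open>Y\<close>.
  (\<^const>\<open>prob_space.indep_var\<close> requires both variables to have the same value type.)\<close>

definition process_indep_var :: "'a measure \<Rightarrow> (real \<Rightarrow> 'a \<Rightarrow> real) \<Rightarrow> ('a \<Rightarrow> real) \<Rightarrow> bool" where
  "process_indep_var M X Y \<longleftrightarrow>
     prob_space.indep_set M
       (sets (vimage_algebra (space M) (\<lambda>\<omega>. \<lambda>t\<in>{0..}. X t \<omega>) (\<Pi>\<^sub>M t\<in>{0..}. borel)))
       (sets (vimage_algebra (space M) Y borel))"

text \<open>Measurability of both processes is part of the definition, since \<^const>\<open>distr\<close> is only
  meaningful for measurable maps.\<close>

definition equal_in_law ::
    "'a measure \<Rightarrow> (real \<Rightarrow> 'a \<Rightarrow> real) \<Rightarrow> 'b measure \<Rightarrow> (real \<Rightarrow> 'b \<Rightarrow> real) \<Rightarrow> bool" where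
  "equal_in_law M X N Z \<longleftrightarrow>
     real_process M X \<and> real_process N Z \<and>
     (\<forall>J. finite J \<longrightarrow> J \<subseteq> {0..} \<longrightarrow>
        distr M (\<Pi>\<^sub>M t\<in>J. borel) (\<lambda>\<omega>. \<lambda>t\<in>J. X t \<omega>)
        = distr N (\<Pi>\<^sub>M t\<in>J. borel) (\<lambda>\<omega>. \<lambda>t\<in>J. Z t \<omega>))"

end

theory Submission
  imports Defs
begin

text \<open>Both processes have the same finite-dimensional characteristic functions. Fix finitely many times
  \<open>t\<close> and frequencies \<open>c t\<close>, and let \<open>Q\<close> be the quadratic form of the fractional Brownian
  covariance at \<open>c\<close>. Given \<open>Y = y\<close>, the linear combination of the values
  \<open>B (t * y powr (1 / \<alpha>))\<close> is centered Gaussian, and since the covariance is homogeneous of degree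
  \<open>\<alpha>\<close>, its variance is \<open>y * Q\<close>. Hence its characteristic function is \<open>exp (- y * Q / 2)\<close>, and
  averaging over the law of \<open>Y\<close> gives the Laplace transform of the M-Wright density at \<open>Q / 2\<close>,
  that is \<open>E\<^sub>\<beta> (- Q / 2)\<close>. This is the characteristic function that defines generalized grey
  Brownian motion.

  Two points need work. First, laws on a finite product of lines must be recovered from their
  characteristic functions; \<open>process_char_eq_imp_distr_eq\<close> derives this from Levy's
  one-dimensional uniqueness theorem by exchanging exponential factors for indicators, one
  coordinate at a time. Second, conditioning on \<open>Y\<close> must be justified although \<open>Y\<close> enters through
  the time argument of the process; \<open>time_changed_fbm\<close> does so by Fubini, using the joint
  measurability that continuity of the paths provides.\<close>

section \<open>Uniqueness of characteristic functions on finite products\<close>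

text \<open>Tilting by a nonnegative weight and normalising turns a weighted expectation of a function of
  \<^term>\<open>X\<close> into an expectation under a probability law on the line, so that the classical
  one-dimensional theory of characteristic functions becomes applicable.\<close>

lemma weighted_law:
  fixes X W :: "'a \<Rightarrow> real"
  assumes X [measurable]: "X \<in> borel_measurable M" and W: "integrable M W"
    and nonneg: "\<And>\<omega>. 0 \<le> W \<omega>" and c: "(\<integral>\<omega>. W \<omega> \<partial>M) = c" "0 < c"
  defines "D \<equiv> distr (density M (\<lambda>\<omega>. ennreal (W \<omega> / c))) borel X"
  shows "real_distribution D"
    and "char D u = (\<integral>\<omega>. W \<omega> *\<^sub>R iexp (u * X \<omega>) \<partial>M) / c"
    and "A \<in> sets borel \<Longrightarrow> measure D A = (\<integral>\<omega>. indicator A (X \<omega>) * W \<omega> \<partial>M) / c"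
proof -
  have [measurable]: "W \<in> borel_measurable M" using W by auto
  have expect: "(\<integral>x. f x \<partial>D) = (\<integral>\<omega>. (W \<omega> / c) *\<^sub>R f (X \<omega>) \<partial>M)"
    if [measurable]: "f \<in> borel_measurable borel" for f :: "real \<Rightarrow> 'c :: {banach, second_countable_topology}"
    unfolding D_def using nonneg c by (subst integral_distr, simp, simp, subst integral_density) auto
  have "(\<integral>\<^sup>+\<omega>. ennreal (W \<omega> / c) \<partial>M) = ennreal (\<integral>\<omega>. W \<omega> / c \<partial>M)"
    using nonneg c W by (intro nn_integral_eq_integral) auto
  also have "\<dots> = 1" using c by simp
  finally have "prob_space (density M (\<lambda>\<omega>. ennreal (W \<omega> / c)))"
    by (intro prob_spaceI) (simp add: emeasure_density cong: nn_integral_cong)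
  then show D: "real_distribution D"
    unfolding D_def by (intro prob_space.real_distribution_distr) auto
  show "char D u = (\<integral>\<omega>. W \<omega> *\<^sub>R iexp (u * X \<omega>) \<partial>M) / c"
    unfolding char_def by (subst expect) (auto simp: scaleR_conv_of_real)
  interpret D: real_distribution D by fact
  show "measure D A = (\<integral>\<omega>. indicator A (X \<omega>) * W \<omega> \<partial>M) / c" if [measurable]: "A \<in> sets borel"
  proof -
    have "measure D A = (\<integral>x. indicator A x \<partial>D)"
      by simp
    also have "\<dots> = (\<integral>\<omega>. (W \<omega> / c) *\<^sub>R indicator A (X \<omega>) \<partial>M)" by (intro expect) simp
    finally show ?thesis by (simp add: mult.commute)
  qed
qed

text \<open>If the total mass vanishes, the weight is almost everywhere zero and both sides are zero.
  Otherwise both tilted laws are probability laws with the same characteristic function, and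
  Levy's uniqueness theorem identifies them.\<close>

lemma weighted_Levy_uniqueness:
  fixes X W :: "'a \<Rightarrow> real" and X' W' :: "'b \<Rightarrow> real"
  assumes meas: "X \<in> borel_measurable M" "X' \<in> borel_measurable N"
    and int: "integrable M W" "integrable N W'"
    and nonneg: "\<And>\<omega>. 0 \<le> W \<omega>" "\<And>\<omega>. 0 \<le> W' \<omega>"
    and eq: "\<And>u. (\<integral>\<omega>. W \<omega> *\<^sub>R iexp (u * X \<omega>) \<partial>M) = (\<integral>\<omega>. W' \<omega> *\<^sub>R iexp (u * X' \<omega>) \<partial>N)"
    and A: "A \<in> sets borel"
  shows "(\<integral>\<omega>. indicator A (X \<omega>) * W \<omega> \<partial>M) = (\<integral>\<omega>. indicator A (X' \<omega>) * W' \<omega> \<partial>N)"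
proof -
  define c where "c = (\<integral>\<omega>. W \<omega> \<partial>M)"
  have tot: "(\<integral>\<omega>. W' \<omega> \<partial>N) = c"
  proof -
    have "complex_of_real (\<integral>\<omega>. W \<omega> \<partial>M) = complex_of_real (\<integral>\<omega>. W' \<omega> \<partial>N)"
      using eq[of 0] by (simp add: scaleR_conv_of_real flip: integral_complex_of_real)
    then show ?thesis unfolding c_def using of_real_eq_iff by metis
  qed
  have c_nonneg: "0 \<le> c" unfolding c_def using nonneg by simp
  show ?thesis
  proof (cases "c = 0")
    case True
    have "AE \<omega> in M. W \<omega> = 0" "AE \<omega> in N. W' \<omega> = 0"
      using True tot int nonneg c_def integral_nonneg_eq_0_iff_AE[of M W]
        integral_nonneg_eq_0_iff_AE[of N W'] by simp_all
    then have "(\<integral>\<omega>. indicator A (X \<omega>) * W \<omega> \<partial>M) = 0" "(\<integral>\<omega>. indicator A (X' \<omega>) * W' \<omega> \<partial>N) = 0"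
      by (auto intro!: integral_eq_zero_AE)
    then show ?thesis by simp
  next
    case False
    then have c: "0 < c" using c_nonneg by simp
    note L = weighted_law[OF meas(1) int(1) nonneg(1) c_def[symmetric] c]
      and L' = weighted_law[OF meas(2) int(2) nonneg(2) tot c]
    have "distr (density M (\<lambda>\<omega>. ennreal (W \<omega> / c))) borel X
        = distr (density N (\<lambda>\<omega>. ennreal (W' \<omega> / c))) borel X'"
      by (rule Levy_uniqueness[OF L(1) L'(1)]) (intro ext, simp only: L(2) L'(2) eq)
    then show ?thesis using L(3)[OF A] L'(3)[OF A] c by simp
  qed
qed

lemma integrable_weighted_iexp:
  assumes "integrable M W" "S \<in> borel_measurable M"
  shows "integrable M (\<lambda>\<omega>. W \<omega> *\<^sub>R iexp (S \<omega>))"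
proof (rule Bochner_Integration.integrable_bound[OF assms(1)])
  show "(\<lambda>\<omega>. W \<omega> *\<^sub>R iexp (S \<omega>)) \<in> borel_measurable M"
    using assms by measurable
qed simp

text \<open>Trading one frequency variable for an event. For fixed second frequency the weight
  \<open>W e\<^sup>i\<^sup>S\<close> is complex, so the previous lemma does not apply to it. It does apply to the
  weights \<open>W (1 + Re (z e\<^sup>i\<^sup>S))\<close> with \<open>\<bar>z\<bar> = 1\<close>, which are nonnegative, and whose
  Fourier transforms in the first frequency are combinations of the given data at the second
  frequencies 0, 1 and -1. The values \<open>z = 1\<close> and \<open>z = - \<i>\<close> produce \<open>1 + cos S\<close> and
  \<open>1 + sin S\<close>, from which \<open>e\<^sup>i\<^sup>S\<close> is recovered linearly.\<close>

lemma weighted_Levy_uniqueness_iexp: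
  fixes X W S :: "'a \<Rightarrow> real" and X' W' S' :: "'b \<Rightarrow> real"
  assumes meas: "X \<in> borel_measurable M" "S \<in> borel_measurable M"
      "X' \<in> borel_measurable N" "S' \<in> borel_measurable N"
    and int: "integrable M W" "integrable N W'"
    and nonneg: "\<And>\<omega>. 0 \<le> W \<omega>" "\<And>\<omega>. 0 \<le> W' \<omega>"
    and eq: "\<And>u v. (\<integral>\<omega>. W \<omega> *\<^sub>R iexp (u * X \<omega> + v * S \<omega>) \<partial>M) = (\<integral>\<omega>. W' \<omega> *\<^sub>R iexp (u * X' \<omega> + v * S' \<omega>) \<partial>N)"
    and A: "A \<in> sets borel"
  shows "(\<integral>\<omega>. (indicator A (X \<omega>) * W \<omega>) *\<^sub>R iexp (S \<omega>) \<partial>M) = (\<integral>\<omega>. (indicator A (X' \<omega>) * W' \<omega>) *\<^sub>R iexp (S' \<omega>) \<partial>N)"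
proof -
  define V where "V z s = 1 + Re (z * iexp s)" for z s
  have V_nonneg: "0 \<le> V z s" if "norm z = 1" for z s
  proof -
    have "\<bar>Re (z * iexp s)\<bar> \<le> norm (z * iexp s)" by (rule abs_Re_le_cmod)
    also have "\<dots> = 1" using that by (simp add: norm_mult)
    finally show ?thesis unfolding V_def by linarith
  qed
  have V_le: "\<bar>V z s\<bar> \<le> 2" if "norm z = 1" for z s
  proof -
    have "\<bar>Re (z * iexp s)\<bar> \<le> norm (z * iexp s)" by (rule abs_Re_le_cmod)
    also have "\<dots> = 1" using that by (simp add: norm_mult)
    finally show ?thesis unfolding V_def by linarith
  qed
  have V_meas [measurable]: "V z \<in> borel_measurable borel" for z
    unfolding V_def by measurable
  have iexp_V: "V z s *\<^sub>R iexp x = iexp x + (z / 2) * iexp (x + s) + (cnj z / 2) * iexp (x - s)"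
    for z s x
  proof -
    have "complex_of_real (V z s) = 1 + (z * iexp s + cnj z * iexp (- s)) / 2"
    proof -
      have "cnj (iexp s) = iexp (- s)" by (simp add: exp_cnj)
      then show ?thesis unfolding V_def using complex_add_cnj[of "z * iexp s"] by simp
    qed
    moreover have "iexp (x + s) = iexp x * iexp s" "iexp (x - s) = iexp x * iexp (- s)"
      by (simp_all add: exp_add[symmetric] algebra_simps)
    ultimately show ?thesis by (simp only: scaleR_conv_of_real) (simp add: field_simps)
  qed
  have V_recover: "iexp s = V 1 s + \<i> * V (- \<i>) s - (1 + \<i>)" for s
    unfolding V_def by (simp add: complex_eq_iff Re_exp Im_exp)
  have expand: "(\<integral>\<omega>. (V z (Q \<omega>) * U \<omega>) *\<^sub>R iexp (u * Z \<omega>) \<partial>P)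
      = (\<integral>\<omega>. U \<omega> *\<^sub>R iexp (u * Z \<omega> + 0 * Q \<omega>) \<partial>P)
      + (z / 2) * (\<integral>\<omega>. U \<omega> *\<^sub>R iexp (u * Z \<omega> + 1 * Q \<omega>) \<partial>P)
      + (cnj z / 2) * (\<integral>\<omega>. U \<omega> *\<^sub>R iexp (u * Z \<omega> + (-1) * Q \<omega>) \<partial>P)"
    if [measurable]: "Z \<in> borel_measurable P" "Q \<in> borel_measurable P" and U: "integrable P U"
    for P :: "'c measure" and Z Q U z u
  proof -
    have I: "integrable P (\<lambda>\<omega>. U \<omega> *\<^sub>R iexp (u * Z \<omega> + v * Q \<omega>))" for v
      by (rule integrable_weighted_iexp[OF U]) measurable
    have "(\<integral>\<omega>. (V z (Q \<omega>) * U \<omega>) *\<^sub>R iexp (u * Z \<omega>) \<partial>P)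
      = (\<integral>\<omega>. U \<omega> *\<^sub>R iexp (u * Z \<omega> + 0 * Q \<omega>)
          + (z / 2) * (U \<omega> *\<^sub>R iexp (u * Z \<omega> + 1 * Q \<omega>))
          + (cnj z / 2) * (U \<omega> *\<^sub>R iexp (u * Z \<omega> + (-1) * Q \<omega>)) \<partial>P)"
    proof (rule Bochner_Integration.integral_cong[OF refl])
      fix \<omega>
      have "(V z (Q \<omega>) * U \<omega>) *\<^sub>R iexp (u * Z \<omega>) = U \<omega> *\<^sub>R (V z (Q \<omega>) *\<^sub>R iexp (u * Z \<omega>))"
        by simp
      also have "\<dots> = U \<omega> *\<^sub>R (iexp (u * Z \<omega>) + (z / 2) * iexp (u * Z \<omega> + Q \<omega>) + (cnj z / 2) * iexp (u * Z \<omega> - Q \<omega>))"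
        by (simp only: iexp_V)
      finally show "(V z (Q \<omega>) * U \<omega>) *\<^sub>R iexp (u * Z \<omega>) = U \<omega> *\<^sub>R iexp (u * Z \<omega> + 0 * Q \<omega>)
          + (z / 2) * (U \<omega> *\<^sub>R iexp (u * Z \<omega> + 1 * Q \<omega>))
          + (cnj z / 2) * (U \<omega> *\<^sub>R iexp (u * Z \<omega> + (-1) * Q \<omega>))"
        by (simp add: scaleR_add_right)
    qed
    also have "\<dots> = (\<integral>\<omega>. U \<omega> *\<^sub>R iexp (u * Z \<omega> + 0 * Q \<omega>) \<partial>P)
      + (z / 2) * (\<integral>\<omega>. U \<omega> *\<^sub>R iexp (u * Z \<omega> + 1 * Q \<omega>) \<partial>P)
      + (cnj z / 2) * (\<integral>\<omega>. U \<omega> *\<^sub>R iexp (u * Z \<omega> + (-1) * Q \<omega>) \<partial>P)"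
      by (subst Bochner_Integration.integral_add | intro Bochner_Integration.integrable_add integrable_mult_right I
          | simp only: integral_mult_right_zero)+
    finally show ?thesis .
  qed
  have V_int: "integrable P (\<lambda>\<omega>. V z (Q \<omega>) * U \<omega>)"
    if z: "norm z = 1" and [measurable]: "Q \<in> borel_measurable P" and U: "integrable P U"
    for P :: "'c measure" and z Q U
  proof (rule Bochner_Integration.integrable_bound)
    show "integrable P (\<lambda>\<omega>. 2 * U \<omega>)" using U by simp
    show "(\<lambda>\<omega>. V z (Q \<omega>) * U \<omega>) \<in> borel_measurable P" using U by measurable
    show "AE \<omega> in P. norm (V z (Q \<omega>) * U \<omega>) \<le> norm (2 * U \<omega>)"
      using V_le[OF z] by (auto simp: abs_mult intro!: mult_right_mono)
  qed
  have key: "(\<integral>\<omega>. indicator A (X \<omega>) * (V z (S \<omega>) * W \<omega>) \<partial>M)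
      = (\<integral>\<omega>. indicator A (X' \<omega>) * (V z (S' \<omega>) * W' \<omega>) \<partial>N)" if "norm z = 1" for z
    using that meas int nonneg V_nonneg A
    by (intro weighted_Levy_uniqueness V_int) (auto simp only: expand eq intro!: mult_nonneg_nonneg)
  have key0: "(\<integral>\<omega>. indicator A (X \<omega>) * W \<omega> \<partial>M) = (\<integral>\<omega>. indicator A (X' \<omega>) * W' \<omega> \<partial>N)"
    using eq[of _ 0] by (intro weighted_Levy_uniqueness meas int nonneg A) simp
  have split: "(\<integral>\<omega>. (indicator A (Z \<omega>) * U \<omega>) *\<^sub>R iexp (Q \<omega>) \<partial>P)
     = complex_of_real (\<integral>\<omega>. indicator A (Z \<omega>) * (V 1 (Q \<omega>) * U \<omega>) \<partial>P)
     + \<i> * complex_of_real (\<integral>\<omega>. indicator A (Z \<omega>) * (V (- \<i>) (Q \<omega>) * U \<omega>) \<partial>P)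
     - (1 + \<i>) * complex_of_real (\<integral>\<omega>. indicator A (Z \<omega>) * U \<omega> \<partial>P)"
    if [measurable]: "Z \<in> borel_measurable P" "Q \<in> borel_measurable P" and U: "integrable P U"
    for P :: "'c measure" and Z Q U
  proof -
    have I: "integrable P (\<lambda>\<omega>. complex_of_real (indicator A (Z \<omega>) * T \<omega>))"
      if T: "integrable P T" for T
    proof (intro integrable_of_real, rule Bochner_Integration.integrable_bound[OF T])
      show "(\<lambda>\<omega>. indicator A (Z \<omega>) * T \<omega>) \<in> borel_measurable P" using T A by measurable
    qed (auto simp: indicator_def)
    note I' = I[OF V_int[of 1 Q P U]] I[OF V_int[of "-\<i>" Q P U]] I[OF U]
    have "(\<integral>\<omega>. (indicator A (Z \<omega>) * U \<omega>) *\<^sub>R iexp (Q \<omega>) \<partial>P)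
      = (\<integral>\<omega>. complex_of_real (indicator A (Z \<omega>) * (V 1 (Q \<omega>) * U \<omega>))
          + \<i> * complex_of_real (indicator A (Z \<omega>) * (V (- \<i>) (Q \<omega>) * U \<omega>))
          - (1 + \<i>) * complex_of_real (indicator A (Z \<omega>) * U \<omega>) \<partial>P)"
      by (intro Bochner_Integration.integral_cong refl)
        (simp add: V_recover scaleR_conv_of_real algebra_simps)
    also have "\<dots> = (\<integral>\<omega>. complex_of_real (indicator A (Z \<omega>) * (V 1 (Q \<omega>) * U \<omega>)) \<partial>P)
          + \<i> * (\<integral>\<omega>. complex_of_real (indicator A (Z \<omega>) * (V (- \<i>) (Q \<omega>) * U \<omega>)) \<partial>P)
          - (1 + \<i>) * (\<integral>\<omega>. complex_of_real (indicator A (Z \<omega>) * U \<omega>) \<partial>P)"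
    proof -
      have J1: "integrable P (\<lambda>\<omega>. complex_of_real (indicator A (Z \<omega>) * (V 1 (Q \<omega>) * U \<omega>)))"
        by (rule I'(1)[OF _ that(2) U]) (rule norm_one)
      have J2: "integrable P (\<lambda>\<omega>. \<i> * complex_of_real (indicator A (Z \<omega>) * (V (- \<i>) (Q \<omega>) * U \<omega>)))"
        by (rule integrable_mult_right, rule I'(2)[OF _ that(2) U]) simp
      have J3: "integrable P (\<lambda>\<omega>. (1 + \<i>) * complex_of_real (indicator A (Z \<omega>) * U \<omega>))"
        by (rule integrable_mult_right, rule I'(3))
      show ?thesis
        by (simp only: Bochner_Integration.integral_diff[OF Bochner_Integration.integrable_add[OF J1 J2] J3]
            Bochner_Integration.integral_add[OF J1 J2] integral_mult_right_zero)
    qed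
    finally show ?thesis by (simp only: integral_complex_of_real)
  qed
  show ?thesis
    using key[of 1] key[of "- \<i>"] key0 meas int by (simp add: split)
qed

text \<open>Uniqueness of characteristic functions in several variables, by replacing the factors
  \<open>exp (\<i> c\<^sub>j X\<^sub>j)\<close> one at a time by indicators of arbitrary Borel events in \<open>X\<^sub>j\<close>. When all
  factors have been replaced, the identity says that the two laws agree on boxes, and boxes
  generate the product \<open>\<sigma>\<close>-algebra.\<close>

theorem process_char_eq_imp_distr_eq:
  fixes X :: "'i \<Rightarrow> 'a \<Rightarrow> real" and X' :: "'i \<Rightarrow> 'b \<Rightarrow> real"
  assumes M: "prob_space M" and N: "prob_space N" and J: "finite J"
    and X [measurable]: "\<And>j. j \<in> J \<Longrightarrow> X j \<in> borel_measurable M"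
    and X' [measurable]: "\<And>j. j \<in> J \<Longrightarrow> X' j \<in> borel_measurable N"
    and eq: "\<And>c. (\<integral>\<omega>. iexp (\<Sum>j\<in>J. c j * X j \<omega>) \<partial>M) = (\<integral>\<omega>. iexp (\<Sum>j\<in>J. c j * X' j \<omega>) \<partial>N)"
  shows "distr M (\<Pi>\<^sub>M j\<in>J. borel) (\<lambda>\<omega>. \<lambda>j\<in>J. X j \<omega>) = distr N (\<Pi>\<^sub>M j\<in>J. borel) (\<lambda>\<omega>. \<lambda>j\<in>J. X' j \<omega>)"
proof -
  interpret M: prob_space M by fact
  interpret N: prob_space N by fact
  \<comment> \<open>The induction runs over the set \<open>K\<close> of coordinates already replaced by indicators.\<close>
  have mixed: "(\<integral>\<omega>. (\<Prod>k\<in>K. indicat_real (A k) (X k \<omega>)) *\<^sub>R iexp (\<Sum>j\<in>J - K. c j * X j \<omega>) \<partial>M)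
      = (\<integral>\<omega>. (\<Prod>k\<in>K. indicat_real (A k) (X' k \<omega>)) *\<^sub>R iexp (\<Sum>j\<in>J - K. c j * X' j \<omega>) \<partial>N)"
    if A: "\<And>k. k \<in> J \<Longrightarrow> A k \<in> sets borel" and K: "finite K" "K \<subseteq> J" for A K c
    using K
  proof (induction K arbitrary: c rule: finite_subset_induct')
    case empty
    show ?case using eq[of c] by simp
  next
    case (insert k K)
    have fin: "finite K" and KJ: "k \<in> J" "K \<subseteq> J" "k \<notin> K" using insert by auto
    have split: "J - K = insert k (J - insert k K)" "k \<notin> J - insert k K" "finite (J - insert k K)"
      using KJ J by auto
    \<comment> \<open>The hypothesis is used at frequency \<open>u\<close> for the new coordinate \<open>k\<close> and at \<open>v\<close> times the
      given frequencies for those not yet replaced.\<close>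
    have comb: "(\<Sum>j\<in>J - K. (if j = k then u else v * c j) * Z j) = u * Z k + v * (\<Sum>j\<in>J - insert k K. c j * Z j)"
      for u v and Z :: "'i \<Rightarrow> real"
    proof -
      have "(\<Sum>j\<in>J - insert k K. (if j = k then u else v * c j) * Z j) = (\<Sum>j\<in>J - insert k K. v * (c j * Z j))"
        by (intro sum.cong) auto
      then show ?thesis unfolding split(1) using split(2,3) by (simp add: sum_distrib_left)
    qed
    have int: "integrable P (\<lambda>\<omega>. \<Prod>k\<in>K. indicat_real (A k) (Z k \<omega>))"
      if P: "prob_space P" and Z: "\<And>j. j \<in> J \<Longrightarrow> Z j \<in> borel_measurable P"
      for P :: "'c measure" and Z
    proof -
      interpret P: prob_space P by fact
      show ?thesis
      proof (rule P.integrable_const_bound[of _ 1])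
        show "AE \<omega> in P. norm (\<Prod>k\<in>K. indicat_real (A k) (Z k \<omega>)) \<le> 1"
          by (simp add: abs_prod prod_le_1)
        show "(\<lambda>\<omega>. \<Prod>k\<in>K. indicat_real (A k) (Z k \<omega>)) \<in> borel_measurable P"
        proof (rule borel_measurable_prod)
          fix i assume "i \<in> K"
          then have "i \<in> J" using KJ by auto
          then show "(\<lambda>\<omega>. indicat_real (A i) (Z i \<omega>)) \<in> borel_measurable P"
            by (intro measurable_compose[OF Z borel_measurable_indicator] A)
        qed
      qed
    qed
    have "(\<integral>\<omega>. (indicat_real (A k) (X k \<omega>) * (\<Prod>k\<in>K. indicat_real (A k) (X k \<omega>))) *\<^sub>R iexp (\<Sum>j\<in>J - insert k K. c j * X j \<omega>) \<partial>M)
      = (\<integral>\<omega>. (indicat_real (A k) (X' k \<omega>) * (\<Prod>k\<in>K. indicat_real (A k) (X' k \<omega>))) *\<^sub>R iexp (\<Sum>j\<in>J - insert k K. c j * X' j \<omega>) \<partial>N)"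
    proof (rule weighted_Levy_uniqueness_iexp)
      fix u v
      show "(\<integral>\<omega>. (\<Prod>k\<in>K. indicat_real (A k) (X k \<omega>)) *\<^sub>R iexp (u * X k \<omega> + v * (\<Sum>j\<in>J - insert k K. c j * X j \<omega>)) \<partial>M)
        = (\<integral>\<omega>. (\<Prod>k\<in>K. indicat_real (A k) (X' k \<omega>)) *\<^sub>R iexp (u * X' k \<omega> + v * (\<Sum>j\<in>J - insert k K. c j * X' j \<omega>)) \<partial>N)"
        using insert.IH[of "\<lambda>j. if j = k then u else v * c j"] by (simp only: comb)
    next
      show "(\<lambda>\<omega>. \<Sum>j\<in>J - insert k K. c j * X j \<omega>) \<in> borel_measurable M"
        by (intro borel_measurable_sum borel_measurable_times borel_measurable_const X) simp
      show "(\<lambda>\<omega>. \<Sum>j\<in>J - insert k K. c j * X' j \<omega>) \<in> borel_measurable N"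
        by (intro borel_measurable_sum borel_measurable_times borel_measurable_const X') simp
    qed (use KJ A in \<open>simp_all add: X X' int[OF M X] int[OF N X'] prod_nonneg\<close>)
    then show ?case using fin KJ by simp
  qed
  \<comment> \<open>For \<open>K = J\<close> the exponential has an empty sum in its exponent and equals 1; keeping it in
    the formula makes the right-hand side an instance of the preceding identity.\<close>
  have eq_PiE: "emeasure (distr P (\<Pi>\<^sub>M j\<in>J. borel) (\<lambda>\<omega>. \<lambda>j\<in>J. Z j \<omega>)) (Pi\<^sub>E J A)
      = ennreal (Re (\<integral>\<omega>. (\<Prod>k\<in>J. indicat_real (A k) (Z k \<omega>)) *\<^sub>R iexp (\<Sum>j\<in>J - J. 0 * Z j \<omega>) \<partial>P))"
    if P: "prob_space P" and Z [measurable]: "\<And>j. j \<in> J \<Longrightarrow> Z j \<in> borel_measurable P"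
      and A [measurable]: "\<And>j. j \<in> J \<Longrightarrow> A j \<in> sets borel"
    for P :: "'c measure" and Z A
  proof -
    interpret P: prob_space P by fact
    let ?E = "{\<omega> \<in> space P. \<forall>j\<in>J. Z j \<omega> \<in> A j}"
    have [measurable]: "?E \<in> sets P" using J by measurable
    have prod: "(\<Prod>k\<in>J. indicat_real (A k) (Z k \<omega>)) = indicat_real ?E \<omega>" if "\<omega> \<in> space P" for \<omega>
      using that J by (auto simp: indicator_def)
    have "emeasure (distr P (\<Pi>\<^sub>M j\<in>J. borel) (\<lambda>\<omega>. \<lambda>j\<in>J. Z j \<omega>)) (Pi\<^sub>E J A)
        = emeasure P ((\<lambda>\<omega>. \<lambda>j\<in>J. Z j \<omega>) -` Pi\<^sub>E J A \<inter> space P)"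
      using J by (intro emeasure_distr sets_PiM_I_finite measurable_restrict) auto
    also have "(\<lambda>\<omega>. \<lambda>j\<in>J. Z j \<omega>) -` Pi\<^sub>E J A \<inter> space P = ?E"
      by (auto simp: PiE_iff)
    also have "emeasure P ?E = ennreal (\<integral>\<omega>. indicat_real ?E \<omega> \<partial>P)"
      by (simp add: P.emeasure_eq_measure)
    also have "(\<integral>\<omega>. indicat_real ?E \<omega> \<partial>P) = Re (complex_of_real (\<integral>\<omega>. indicat_real ?E \<omega> \<partial>P))"
      by simp
    also have "complex_of_real (\<integral>\<omega>. indicat_real ?E \<omega> \<partial>P)
        = (\<integral>\<omega>. (\<Prod>k\<in>J. indicat_real (A k) (Z k \<omega>)) *\<^sub>R iexp (\<Sum>j\<in>J - J. 0 * Z j \<omega>) \<partial>P)"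
      unfolding integral_complex_of_real[symmetric]
      by (intro Bochner_Integration.integral_cong) (simp_all add: prod scaleR_conv_of_real)
    finally show ?thesis .
  qed
  show ?thesis
  proof (rule measure_eqI_PiM_finite[OF J, where A = "\<lambda>_. \<Pi>\<^sub>E j\<in>J. UNIV"])
    fix A :: "'i \<Rightarrow> real set" assume A: "\<And>j. j \<in> J \<Longrightarrow> A j \<in> sets borel"
    show "emeasure (distr M (\<Pi>\<^sub>M j\<in>J. borel) (\<lambda>\<omega>. \<lambda>j\<in>J. X j \<omega>)) (Pi\<^sub>E J A)
        = emeasure (distr N (\<Pi>\<^sub>M j\<in>J. borel) (\<lambda>\<omega>. \<lambda>j\<in>J. X' j \<omega>)) (Pi\<^sub>E J A)"
      by (subst eq_PiE[OF M X A], assumption+, subst eq_PiE[OF N X' A], assumption+)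
        (simp only: mixed[of A J "\<lambda>_. 0", OF A J subset_refl])
  next
    have "prob_space (distr M (\<Pi>\<^sub>M j\<in>J. borel) (\<lambda>\<omega>. \<lambda>j\<in>J. X j \<omega>))"
      by (intro M.prob_space_distr measurable_restrict X)
    then show "emeasure (distr M (\<Pi>\<^sub>M j\<in>J. borel) (\<lambda>\<omega>. \<lambda>j\<in>J. X j \<omega>)) (\<Pi>\<^sub>E j\<in>J. UNIV) \<noteq> \<infinity>"
      by (simp add: prob_space.finite_measure finite_measure.emeasure_finite)
  next
    show "range (\<lambda>_::nat. \<Pi>\<^sub>E j\<in>J. UNIV) \<subseteq> prod_algebra J (\<lambda>_. borel :: real measure)"
      using prod_algebraI_finite[OF J, of "\<lambda>_. UNIV" "\<lambda>_. borel :: real measure"] by auto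
  qed (simp_all add: space_PiM)
qed

section \<open>Characteristic functions of fractional Brownian motion\<close>

text \<open>The nondegenerate case reduces to the known characteristic function of the standard normal
  law, evaluated at the standard deviation; the degenerate case concerns a constant.\<close>

lemma (in prob_space) gaussian_rv_moments_char:
  assumes G: "gaussian_rv M L"
  shows "integrable M L" and "integrable M (\<lambda>\<omega>. (L \<omega>)\<^sup>2)"
    and "expectation L = 0 \<Longrightarrow> expectation (\<lambda>\<omega>. iexp (L \<omega>)) = exp (- expectation (\<lambda>\<omega>. (L \<omega>)\<^sup>2) / 2)"
proof -
  have [measurable]: "L \<in> borel_measurable M" using G by (simp add: gaussian_rv_def)
  have "integrable M L \<and> integrable M (\<lambda>\<omega>. (L \<omega>)\<^sup>2) \<and>
    (expectation L = 0 \<longrightarrow> expectation (\<lambda>\<omega>. iexp (L \<omega>)) = exp (- expectation (\<lambda>\<omega>. (L \<omega>)\<^sup>2) / 2))"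
    using G unfolding gaussian_rv_def
  proof (elim conjE disjE exE)
    fix \<mu> \<sigma> :: real assume \<sigma>: "0 < \<sigma>" and D: "distributed M lborel L (\<lambda>x. ennreal (normal_density \<mu> \<sigma> x))"
    have int1: "integrable M L"
      using integral_normal_moment_nz_1[OF \<sigma>, of \<mu>] integrable_normal_moment_nz_1[OF \<sigma>, of \<mu>]
        distributed_integrable[OF D, of "\<lambda>x. x"] by (simp add: mult.commute)
    have "integrable M (\<lambda>\<omega>. (L \<omega> - \<mu>)\<^sup>2)"
      using integrable_normal_moment[OF \<sigma>, of \<mu> 2] distributed_integrable[OF D, of "\<lambda>x. (x - \<mu>)\<^sup>2"] by simp
    then have "integrable M (\<lambda>\<omega>. (L \<omega> - \<mu>)\<^sup>2 + 2 * \<mu> * L \<omega> - \<mu>\<^sup>2)"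
      using int1 by (intro Bochner_Integration.integrable_diff Bochner_Integration.integrable_add) auto
    then have int2: "integrable M (\<lambda>\<omega>. (L \<omega>)\<^sup>2)"
      by (simp add: power2_eq_square algebra_simps)
    show ?thesis
    proof (intro conjI impI int1 int2)
      assume zero: "expectation L = 0"
      then have \<mu>: "\<mu> = 0" using normal_distributed_expectation[OF \<sigma> D] by simp
      have var: "expectation (\<lambda>\<omega>. (L \<omega>)\<^sup>2) = \<sigma>\<^sup>2"
        using normal_distributed_variance[OF \<sigma> D] zero by simp
      have "distributed M lborel (\<lambda>\<omega>. L \<omega> / \<sigma>) std_normal_density"
        using D normal_standard_normal_convert[OF \<sigma>, of L \<mu>] \<mu> by simp
      then have "distr M lborel (\<lambda>\<omega>. L \<omega> / \<sigma>) = std_normal_distribution"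
        by (simp add: distributed_def)
      moreover have "distr M lborel (\<lambda>\<omega>. L \<omega> / \<sigma>) = distr M borel (\<lambda>\<omega>. L \<omega> / \<sigma>)"
        by (intro distr_cong) auto
      ultimately have "char (distr M borel (\<lambda>\<omega>. L \<omega> / \<sigma>)) \<sigma> = exp (- \<sigma>\<^sup>2 / 2)"
        by (simp add: char_std_normal_distribution)
      then show "expectation (\<lambda>\<omega>. iexp (L \<omega>)) = exp (- expectation (\<lambda>\<omega>. (L \<omega>)\<^sup>2) / 2)"
        unfolding char_def var using \<sigma> by (subst (asm) integral_distr) auto
    qed
  next
    fix \<mu> assume ae: "AE \<omega> in M. L \<omega> = \<mu>"
    have ae': "AE \<omega> in M. (L \<omega>)\<^sup>2 = \<mu>\<^sup>2" "AE \<omega> in M. iexp (L \<omega>) = iexp \<mu>" using ae by auto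
    then have "expectation (\<lambda>\<omega>. (L \<omega>)\<^sup>2) = expectation (\<lambda>_. \<mu>\<^sup>2)"
        "expectation (\<lambda>\<omega>. iexp (L \<omega>)) = expectation (\<lambda>_. iexp \<mu>)"
        "expectation L = expectation (\<lambda>_. \<mu>)" using ae
      by - (rule integral_cong_AE; (measurable; fail) | (simp; fail))+
    moreover have "integrable M L \<longleftrightarrow> integrable M (\<lambda>_. \<mu>)"
        "integrable M (\<lambda>\<omega>. (L \<omega>)\<^sup>2) \<longleftrightarrow> integrable M (\<lambda>_. \<mu>\<^sup>2)"
      using ae ae' by - (rule integrable_cong_AE; (measurable; fail) | (simp; fail))+
    ultimately show ?thesis by (auto simp: prob_space)
  qed
  then show "integrable M L" and "integrable M (\<lambda>\<omega>. (L \<omega>)\<^sup>2)"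
    and "expectation L = 0 \<Longrightarrow> expectation (\<lambda>\<omega>. iexp (L \<omega>)) = exp (- expectation (\<lambda>\<omega>. (L \<omega>)\<^sup>2) / 2)"
    by auto
qed

text \<open>Times may coincide: scaling all times by a random factor sends them all to 0 when that factor
  vanishes. Coefficients of equal times are therefore collected before the defining property of
  a Gaussian process is applied.\<close>

lemma gaussian_process_linear_combination:
  assumes G: "gaussian_process M B" and K: "finite K" "\<And>k. k \<in> K \<Longrightarrow> 0 \<le> \<tau> k"
  shows "gaussian_rv M (\<lambda>\<omega>. \<Sum>k\<in>K. c k * B (\<tau> k) \<omega>)"
proof -
  have "(\<Sum>k\<in>K. c k * B (\<tau> k) \<omega>) = (\<Sum>u\<in>\<tau> ` K. (\<Sum>k\<in>{k\<in>K. \<tau> k = u}. c k) * B u \<omega>)" for \<omega>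
  proof -
    have "(\<Sum>k\<in>K. c k * B (\<tau> k) \<omega>) = (\<Sum>u\<in>\<tau> ` K. \<Sum>k\<in>{k\<in>K. \<tau> k = u}. c k * B (\<tau> k) \<omega>)"
      by (rule sum.image_gen[OF K(1)])
    also have "\<dots> = (\<Sum>u\<in>\<tau> ` K. (\<Sum>k\<in>{k\<in>K. \<tau> k = u}. c k) * B u \<omega>)"
      unfolding sum_distrib_right by (intro sum.cong refl) auto
    finally show ?thesis .
  qed
  moreover have "gaussian_rv M (\<lambda>\<omega>. \<Sum>u\<in>\<tau> ` K. (\<Sum>k\<in>{k\<in>K. \<tau> k = u}. c k) * B u \<omega>)"
    using G K(2) finite_imageI[OF K(1), of \<tau>] unfolding gaussian_process_def by (simp add: image_subset_iff)
  ultimately show ?thesis by simp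
qed

text \<open>The linear combination is centered Gaussian and, by bilinearity of the covariance, its second
  moment is the quadratic form \<open>Q\<close>. The same identification shows that \<open>Q\<close> is nonnegative,
  which places \<open>Q / 2\<close> in the domain of the Laplace transform used below.\<close>

lemma fbm_char:
  fixes c :: "'k \<Rightarrow> real"
  assumes F: "fractional_brownian_motion H M B" and K: "finite K" "\<And>k. k \<in> K \<Longrightarrow> 0 \<le> \<tau> k"
  defines "Q \<equiv> \<Sum>k\<in>K. \<Sum>j\<in>K. c k * fbm_cov (2 * H) (\<tau> k) (\<tau> j) * c j"
  shows "(\<integral>\<omega>. iexp (\<Sum>k\<in>K. c k * B (\<tau> k) \<omega>) \<partial>M) = exp (- Q / 2)" and "0 \<le> Q"
proof -
  have G: "gaussian_process M B" and mean: "\<And>t. 0 \<le> t \<Longrightarrow> (\<integral>\<omega>. B t \<omega> \<partial>M) = 0"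
    and cov: "\<And>t s. 0 \<le> t \<Longrightarrow> 0 \<le> s \<Longrightarrow> (\<integral>\<omega>. B t \<omega> * B s \<omega> \<partial>M) = fbm_cov (2 * H) t s"
    and M: "prob_space M" and meas: "\<And>t. 0 \<le> t \<Longrightarrow> B t \<in> borel_measurable M"
    using F by (auto simp: fractional_brownian_motion_def gaussian_process_def real_process_def)
  interpret prob_space M by fact
  have marginal: "gaussian_rv M (B t)" if "0 \<le> t" for t
    using gaussian_process_linear_combination[OF G, of "{t}" "\<lambda>t. t" "\<lambda>_. 1"] that by simp
  note int = gaussian_rv_moments_char(1)[OF marginal] and sq = gaussian_rv_moments_char(2)[OF marginal]
  have prod: "integrable M (\<lambda>\<omega>. B t \<omega> * B s \<omega>)" if ts: "0 \<le> t" "0 \<le> s" for t s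
  proof (rule Bochner_Integration.integrable_bound)
    show "integrable M (\<lambda>\<omega>. (B t \<omega>)\<^sup>2 + (B s \<omega>)\<^sup>2)" using sq ts by simp
    show "(\<lambda>\<omega>. B t \<omega> * B s \<omega>) \<in> borel_measurable M" using meas ts by simp
    have "\<bar>x * y\<bar> \<le> x\<^sup>2 + y\<^sup>2" for x y :: real
    proof -
      have "2 * \<bar>x * y\<bar> \<le> x\<^sup>2 + y\<^sup>2"
        using sum_squares_bound[of "\<bar>x\<bar>" "\<bar>y\<bar>"] by (simp add: abs_mult)
      then show ?thesis using abs_ge_zero[of "x * y"] by linarith
    qed
    then show "AE \<omega> in M. norm (B t \<omega> * B s \<omega>) \<le> norm ((B t \<omega>)\<^sup>2 + (B s \<omega>)\<^sup>2)" by simp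
  qed
  define L where "L = (\<lambda>\<omega>. \<Sum>k\<in>K. c k * B (\<tau> k) \<omega>)"
  have L: "gaussian_rv M L" unfolding L_def by (rule gaussian_process_linear_combination[OF G K])
  have "expectation L = (\<Sum>k\<in>K. c k * expectation (B (\<tau> k)))"
    unfolding L_def using int K by (subst Bochner_Integration.integral_sum) auto
  then have L0: "expectation L = 0" using mean K by simp
  have "(L \<omega>)\<^sup>2 = (\<Sum>k\<in>K. \<Sum>j\<in>K. c k * c j * (B (\<tau> k) \<omega> * B (\<tau> j) \<omega>))" for \<omega>
    unfolding L_def power2_eq_square sum_product by (intro sum.cong refl) (simp add: algebra_simps)
  then have "expectation (\<lambda>\<omega>. (L \<omega>)\<^sup>2) = (\<Sum>k\<in>K. \<Sum>j\<in>K. c k * c j * expectation (\<lambda>\<omega>. B (\<tau> k) \<omega> * B (\<tau> j) \<omega>))"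
    using prod K by (simp add: Bochner_Integration.integral_sum)
  also have "\<dots> = Q"
    unfolding Q_def using cov K by (intro sum.cong refl) (simp add: algebra_simps)
  finally have var: "expectation (\<lambda>\<omega>. (L \<omega>)\<^sup>2) = Q" .
  then show "0 \<le> Q" by (simp flip: var)
  show "(\<integral>\<omega>. iexp (\<Sum>k\<in>K. c k * B (\<tau> k) \<omega>) \<partial>M) = exp (- Q / 2)"
    using gaussian_rv_moments_char(3)[OF L L0] unfolding var by (simp add: L_def)
qed

text \<open>Self-similarity of fractional Brownian motion at the level of covariances.\<close>

lemma fbm_cov_scale:
  assumes "0 \<le> r" "0 \<le> t" "0 \<le> s"
  shows "fbm_cov a (t * r) (s * r) = r powr a * fbm_cov a t s"
proof -
  have "\<bar>t * r - s * r\<bar> = \<bar>t - s\<bar> * r"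
    using assms by (simp add: abs_mult flip: left_diff_distrib)
  then show ?thesis using assms by (simp add: fbm_cov_def powr_mult algebra_simps)
qed

section \<open>Independent random change of time\<close>

text \<open>Substituting a random time into a process requires joint measurability in time and outcome.
  Path continuity provides it: the process is the pointwise limit of the processes obtained by
  rounding time down to a multiple of \<open>1 / (n + 1)\<close>, which only involve countably many
  times. The maximum with 0 extends the paths continuously to negative times, where nothing is
  known about \<^term>\<open>B\<close>.\<close>

lemma continuous_process_jointly_measurable:
  fixes B :: "real \<Rightarrow> 'a \<Rightarrow> real"
  assumes meas: "\<And>t. 0 \<le> t \<Longrightarrow> B t \<in> borel_measurable V"
    and cont: "\<And>\<omega>. \<omega> \<in> space V \<Longrightarrow> continuous_on {0..} (\<lambda>t. B t \<omega>)"
  shows "(\<lambda>(\<omega>, t). B (max 0 t) \<omega>) \<in> borel_measurable (V \<Otimes>\<^sub>M borel)"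
proof -
  define d where "d n t = real_of_int \<lfloor>max 0 t * real (Suc n)\<rfloor> / real (Suc n)" for n and t :: real
  have d_nonneg: "0 \<le> d n t" for n t by (simp add: d_def)
  have d_lim: "(\<lambda>n. d n t) \<longlonglongrightarrow> max 0 t" for t
  proof (rule tendsto_sandwich)
    show "\<forall>\<^sub>F n in sequentially. max 0 t - 1 / real (Suc n) \<le> d n t"
    proof (intro always_eventually allI)
      fix n
      have "max 0 t * real (Suc n) - 1 \<le> real_of_int \<lfloor>max 0 t * real (Suc n)\<rfloor>" by linarith
      then have "(max 0 t * real (Suc n) - 1) / real (Suc n) \<le> d n t"
        unfolding d_def by (rule divide_right_mono) simp
      then show "max 0 t - 1 / real (Suc n) \<le> d n t" by (simp add: diff_divide_distrib del: of_nat_Suc)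
    qed
    show "\<forall>\<^sub>F n in sequentially. d n t \<le> max 0 t"
    proof (intro always_eventually allI)
      fix n
      have "d n t \<le> max 0 t * real (Suc n) / real (Suc n)"
        unfolding d_def by (rule divide_right_mono) (linarith, simp)
      then show "d n t \<le> max 0 t" by (simp del: of_nat_Suc)
    qed
    have "(\<lambda>n. max 0 t - 1 / real (Suc n)) \<longlonglongrightarrow> max 0 t - 0"
      by (intro tendsto_diff tendsto_const lim_1_over_n[THEN LIMSEQ_Suc])
    then show "(\<lambda>n. max 0 t - 1 / real (Suc n)) \<longlonglongrightarrow> max 0 t" by simp
  qed simp
  show ?thesis
  proof (rule borel_measurable_LIMSEQ_metric)
    show "(\<lambda>p :: 'a \<times> real. B (d n (snd p)) (fst p)) \<in> borel_measurable (V \<Otimes>\<^sub>M borel)" for n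
    proof -
      have "(\<lambda>p :: 'a \<times> real. B (max 0 (real_of_int i / real (Suc n))) (fst p)) \<in> borel_measurable (V \<Otimes>\<^sub>M borel)" for i
        by (rule measurable_compose[OF measurable_fst meas]) simp
      moreover have "(\<lambda>p :: 'a \<times> real. \<lfloor>max 0 (snd p) * real (Suc n)\<rfloor>) \<in> measurable (V \<Otimes>\<^sub>M borel) (count_space UNIV)"
        by measurable
      ultimately have "(\<lambda>p :: 'a \<times> real. B (max 0 (real_of_int \<lfloor>max 0 (snd p) * real (Suc n)\<rfloor> / real (Suc n))) (fst p)) \<in> borel_measurable (V \<Otimes>\<^sub>M borel)"
        by (rule measurable_compose_countable)
      then show ?thesis using d_nonneg unfolding d_def by (simp add: max_def)
    qed
  next
    fix p :: "'a \<times> real" assume "p \<in> space (V \<Otimes>\<^sub>M borel)"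
    then have "fst p \<in> space V" by (auto simp: space_pair_measure)
    then have "(\<lambda>n. B (d n (snd p)) (fst p)) \<longlonglongrightarrow> B (max 0 (snd p)) (fst p)"
      using d_nonneg d_lim by (intro continuous_on_tendsto_compose[OF cont]) auto
    then show "(\<lambda>n. B (d n (snd p)) (fst p)) \<longlonglongrightarrow> (case p of (\<omega>, t) \<Rightarrow> B (max 0 t) \<omega>)"
      by (simp add: case_prod_beta)
  qed
qed

text \<open>The \<open>\<sigma>\<close>-algebra on the sample space generated by the whole process. Independence from the time
  change is a statement about this \<open>\<sigma>\<close>-algebra, so it is on it, rather than on that of the full
  measure space, that a product law can be formed.\<close>

definition path_algebra :: "'a measure \<Rightarrow> (real \<Rightarrow> 'a \<Rightarrow> real) \<Rightarrow> 'a measure" where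
  "path_algebra M B = vimage_algebra (space M) (\<lambda>\<omega>. \<lambda>t\<in>{0..}. B t \<omega>) (\<Pi>\<^sub>M t\<in>{0..}. borel)"

lemma space_path_algebra [simp]: "space (path_algebra M B) = space M"
  by (simp add: path_algebra_def)

lemma measurable_path_algebra:
  assumes "0 \<le> t" shows "B t \<in> borel_measurable (path_algebra M B)"
proof -
  have "(\<lambda>\<omega>. \<lambda>t\<in>{0..}. B t \<omega>) \<in> measurable (path_algebra M B) (\<Pi>\<^sub>M t\<in>{0..}. borel)"
    unfolding path_algebra_def by (rule measurable_vimage_algebra1) (auto simp: space_PiM)
  then have "(\<lambda>\<omega>. (\<lambda>t\<in>{0..}. B t \<omega>) t) \<in> borel_measurable (path_algebra M B)"
    by (rule measurable_compose[OF _ measurable_component_singleton]) (use assms in simp)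
  then show ?thesis using assms by simp
qed

text \<open>Independence as a product formula. The outcome itself, viewed through the \<open>\<sigma>\<close>-algebra of the
  process, stands in for the path: evaluation at a time is then jointly measurable by continuity
  of the paths, whereas it is not on the space of all functions on the half-line with its product
  \<open>\<sigma>\<close>-algebra.\<close>

lemma process_indep_joint_law:
  assumes "prob_space M" and Y [measurable]: "Y \<in> borel_measurable M" and indep: "process_indep_var M B Y"
  shows "(\<lambda>\<omega>. \<omega>) \<in> measurable M (path_algebra M B)"
    and "distr M (path_algebra M B) (\<lambda>\<omega>. \<omega>) \<Otimes>\<^sub>M distr M borel Y
      = distr M (path_algebra M B \<Otimes>\<^sub>M borel) (\<lambda>\<omega>. (\<omega>, Y \<omega>))"
proof -
  interpret prob_space M by fact
  have ind: "indep_set (sets (path_algebra M B)) (sets (vimage_algebra (space M) Y borel))"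
    using indep by (simp add: process_indep_var_def path_algebra_def)
  then have sub: "sets (path_algebra M B) \<subseteq> sets M" by (rule indep_setD_ev1)
  show id [measurable]: "(\<lambda>\<omega>. \<omega>) \<in> measurable M (path_algebra M B)"
  proof (rule measurableI)
    fix A assume "A \<in> sets (path_algebra M B)"
    then have "A \<in> sets M" using sub by auto
    then show "(\<lambda>\<omega>. \<omega>) -` A \<inter> space M \<in> sets M" by simp
  qed simp
  interpret P: prob_space "distr M (path_algebra M B) (\<lambda>\<omega>. \<omega>)" by (rule prob_space_distr[OF id])
  interpret Y: prob_space "distr M borel Y" by (rule prob_space_distr[OF Y])
  show "distr M (path_algebra M B) (\<lambda>\<omega>. \<omega>) \<Otimes>\<^sub>M distr M borel Y
      = distr M (path_algebra M B \<Otimes>\<^sub>M borel) (\<lambda>\<omega>. (\<omega>, Y \<omega>))"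
  proof (rule pair_measure_eqI)
    fix A C assume "A \<in> sets (distr M (path_algebra M B) (\<lambda>\<omega>. \<omega>))" "C \<in> sets (distr M borel Y)"
    then have A [measurable]: "A \<in> sets (path_algebra M B)" and C [measurable]: "C \<in> sets borel" by auto
    have AM: "A \<inter> space M = A" using sets.sets_into_space[OF A] by auto
    have "prob (A \<inter> (Y -` C \<inter> space M)) = prob A * prob (Y -` C \<inter> space M)"
      using indep_setD[OF ind A] C by (simp add: in_vimage_algebra)
    then have "emeasure M (A \<inter> (Y -` C \<inter> space M)) = emeasure M A * emeasure M (Y -` C \<inter> space M)"
      unfolding emeasure_eq_measure by (simp only: ennreal_mult measure_nonneg)
    moreover have "emeasure (distr M (path_algebra M B) (\<lambda>\<omega>. \<omega>)) A = emeasure M A"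
      by (subst emeasure_distr[OF id A]) (simp add: AM)
    moreover have "emeasure (distr M borel Y) C = emeasure M (Y -` C \<inter> space M)"
      by (rule emeasure_distr[OF Y C])
    moreover have "emeasure (distr M (path_algebra M B \<Otimes>\<^sub>M borel) (\<lambda>\<omega>. (\<omega>, Y \<omega>))) (A \<times> C)
        = emeasure M ((\<lambda>\<omega>. (\<omega>, Y \<omega>)) -` (A \<times> C) \<inter> space M)"
      by (rule emeasure_distr[OF measurable_Pair[OF id Y] pair_measureI[OF A C]])
    moreover have "(\<lambda>\<omega>. (\<omega>, Y \<omega>)) -` (A \<times> C) \<inter> space M = A \<inter> (Y -` C \<inter> space M)" by auto
    ultimately show "emeasure (distr M (path_algebra M B) (\<lambda>\<omega>. \<omega>)) A * emeasure (distr M borel Y) C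
        = emeasure (distr M (path_algebra M B \<Otimes>\<^sub>M borel) (\<lambda>\<omega>. (\<omega>, Y \<omega>))) (A \<times> C)"
      by (simp only:)
  next
    show "sets (distr M (path_algebra M B) (\<lambda>\<omega>. \<omega>) \<Otimes>\<^sub>M distr M borel Y)
        = sets (distr M (path_algebra M B \<Otimes>\<^sub>M borel) (\<lambda>\<omega>. (\<omega>, Y \<omega>)))"
      unfolding sets_distr by (intro sets_pair_measure_cong sets_distr)
  qed (fact P.sigma_finite_measure_axioms Y.sigma_finite_measure_axioms)+
qed

text \<open>Conditioning on the time change. By the product formula and Fubini, the characteristic function
  is the average over \<open>y\<close>, with respect to the law of \<^term>\<open>Y\<close>, of its value with \<^term>\<open>Y\<close>
  frozen at \<open>y\<close>. For frozen \<open>y\<close> all times are multiplied by \<open>r = y powr (1 / \<alpha>)\<close>; by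
  self-similarity this multiplies the quadratic form by \<open>r powr \<alpha> = y\<close>, so that \<open>y\<close> enters the
  Gaussian exponential linearly and the average is a Laplace transform.\<close>

lemma time_changed_fbm:
  fixes c :: "'k \<Rightarrow> real"
  assumes \<alpha>: "0 < \<alpha>" and F: "fractional_brownian_motion (\<alpha> / 2) M B"
    and Y [measurable]: "Y \<in> borel_measurable M" and Y_nonneg: "\<forall>\<omega>\<in>space M. 0 \<le> Y \<omega>"
    and indep: "process_indep_var M B Y"
  shows "0 \<le> t \<Longrightarrow> (\<lambda>\<omega>. B (t * Y \<omega> powr (1 / \<alpha>)) \<omega>) \<in> borel_measurable M"
    and "finite K \<Longrightarrow> (\<And>k. k \<in> K \<Longrightarrow> 0 \<le> \<tau> k) \<Longrightarrow>
      (\<integral>\<omega>. iexp (\<Sum>k\<in>K. c k * B (\<tau> k * Y \<omega> powr (1 / \<alpha>)) \<omega>) \<partial>M)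
      = (\<integral>\<omega>. exp (- (\<Sum>k\<in>K. \<Sum>j\<in>K. c k * fbm_cov \<alpha> (\<tau> k) (\<tau> j) * c j) / 2 * Y \<omega>) \<partial>M)"
proof -
  let ?V = "path_algebra M B"
  let ?P = "distr M ?V (\<lambda>\<omega>. \<omega>)" and ?Y = "distr M borel Y"
  have M: "prob_space M" and cont: "\<And>\<omega>. \<omega> \<in> space M \<Longrightarrow> continuous_on {0..} (\<lambda>t. B t \<omega>)"
    using F by (auto simp: fractional_brownian_motion_def continuous_process_def real_process_def)
  interpret prob_space M by fact
  note id [measurable] = process_indep_joint_law(1)[OF M Y indep]
  note law = process_indep_joint_law(2)[OF M Y indep]
  interpret P: prob_space ?P by (rule prob_space_distr[OF id])
  interpret Y: prob_space ?Y by (rule prob_space_distr[OF Y])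
  interpret PY: pair_sigma_finite ?P ?Y ..
  interpret PYp: pair_prob_space ?P ?Y ..
  have joint: "(\<lambda>p. B (max 0 (t * snd p powr (1 / \<alpha>))) (fst p)) \<in> borel_measurable (?V \<Otimes>\<^sub>M borel)" for t
  proof -
    have "(\<lambda>(\<omega>, t). B (max 0 t) \<omega>) \<in> borel_measurable (?V \<Otimes>\<^sub>M borel)"
      by (rule continuous_process_jointly_measurable) (auto intro: measurable_path_algebra cont)
    moreover have "(\<lambda>p :: 'a \<times> real. (fst p, t * snd p powr (1 / \<alpha>))) \<in> measurable (?V \<Otimes>\<^sub>M borel) (?V \<Otimes>\<^sub>M borel)"
      by measurable
    ultimately have "(\<lambda>p :: 'a \<times> real. case (fst p, t * snd p powr (1 / \<alpha>)) of
        (\<omega>, t) \<Rightarrow> B (max 0 t) \<omega>) \<in> borel_measurable (?V \<Otimes>\<^sub>M borel)"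
      by (rule measurable_compose[rotated])
    then show ?thesis by simp
  qed
  show meas: "(\<lambda>\<omega>. B (t * Y \<omega> powr (1 / \<alpha>)) \<omega>) \<in> borel_measurable M" if "0 \<le> t" for t
  proof -
    have "(\<lambda>\<omega>. (\<omega>, Y \<omega>)) \<in> measurable M (?V \<Otimes>\<^sub>M borel)" by measurable
    from measurable_compose[OF this joint[of t]] show ?thesis using that by (simp add: max_def)
  qed
  assume K: "finite K" "\<And>k. k \<in> K \<Longrightarrow> 0 \<le> \<tau> k"
  define Q where "Q = (\<Sum>k\<in>K. \<Sum>j\<in>K. c k * fbm_cov \<alpha> (\<tau> k) (\<tau> j) * c j)"
  \<comment> \<open>The maximum with 0 is the extension of the paths to negative times for which joint
    measurability is available; it has no effect at the times that occur, which are nonnegative.\<close>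
  define f where "f = (\<lambda>p. iexp (\<Sum>k\<in>K. c k * B (max 0 (\<tau> k * snd p powr (1 / \<alpha>))) (fst p)))"
  have f_meas: "f \<in> borel_measurable (?V \<Otimes>\<^sub>M borel)"
    unfolding f_def using joint by measurable
  have f_int: "integrable (?P \<Otimes>\<^sub>M ?Y) f"
  proof (rule PYp.integrable_const_bound[of _ 1])
    have "sets (?P \<Otimes>\<^sub>M ?Y) = sets (?V \<Otimes>\<^sub>M borel)"
      by (intro sets_pair_measure_cong) simp_all
    from measurable_cong_sets[OF this refl] show "f \<in> borel_measurable (?P \<Otimes>\<^sub>M ?Y)"
      using f_meas by blast
  qed (simp add: f_def)
  have conditional: "(\<integral>\<omega>. f (\<omega>, y) \<partial>?P) = exp (- Q / 2 * y)" if y: "0 \<le> y" for y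
  proof -
    let ?r = "y powr (1 / \<alpha>)"
    have r: "?r powr \<alpha> = y" using y \<alpha> by (simp add: powr_powr)
    have pos: "0 \<le> \<tau> k * ?r" if "k \<in> K" for k using K(2)[OF that] by simp
    have "(\<integral>\<omega>. f (\<omega>, y) \<partial>?P) = (\<integral>\<omega>. f (\<omega>, y) \<partial>M)"
      by (rule integral_distr[OF id]) (rule measurable_compose[OF measurable_Pair2' f_meas], simp)
    also have "\<dots> = (\<integral>\<omega>. iexp (\<Sum>k\<in>K. c k * B (\<tau> k * ?r) \<omega>) \<partial>M)"
      unfolding f_def using pos by (simp add: max_def cong: sum.cong)
    also have "\<dots> = exp (- (\<Sum>k\<in>K. \<Sum>j\<in>K. c k * fbm_cov \<alpha> (\<tau> k * ?r) (\<tau> j * ?r) * c j) / 2)"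
      using fbm_char(1)[OF F K(1), of "\<lambda>k. \<tau> k * ?r" c] pos by simp
    also have "(\<Sum>k\<in>K. \<Sum>j\<in>K. c k * fbm_cov \<alpha> (\<tau> k * ?r) (\<tau> j * ?r) * c j) = Q * y"
      unfolding Q_def sum_distrib_right using K
      by (intro sum.cong refl) (simp add: fbm_cov_scale r mult_ac)
    finally show ?thesis by simp
  qed
  have "(\<integral>\<omega>. iexp (\<Sum>k\<in>K. c k * B (\<tau> k * Y \<omega> powr (1 / \<alpha>)) \<omega>) \<partial>M) = (\<integral>\<omega>. f (\<omega>, Y \<omega>) \<partial>M)"
    unfolding f_def using K by (simp add: max_def cong: sum.cong)
  also have "\<dots> = (\<integral>p. f p \<partial>(?P \<Otimes>\<^sub>M ?Y))"
    unfolding law using f_meas by (subst integral_distr) auto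
  also have "\<dots> = (\<integral>y. (\<integral>\<omega>. f (\<omega>, y) \<partial>?P) \<partial>?Y)"
    using PY.integral_snd[of "\<lambda>\<omega> y. f (\<omega>, y)"] f_int by simp
  also have "\<dots> = (\<integral>y. complex_of_real (exp (- Q / 2 * y)) \<partial>?Y)"
  proof (rule integral_cong_AE)
    show "(\<lambda>y. \<integral>\<omega>. f (\<omega>, y) \<partial>?P) \<in> borel_measurable ?Y"
      using PY.integrable_snd[of "\<lambda>\<omega> y. f (\<omega>, y)"] f_int by (intro borel_measurable_integrable) simp
    have "AE y in ?Y. 0 \<le> y" using Y_nonneg by (subst AE_distr_iff) auto
    then show "AE y in ?Y. (\<integral>\<omega>. f (\<omega>, y) \<partial>?P) = complex_of_real (exp (- Q / 2 * y))"
      using conditional by auto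
  qed simp
  also have "\<dots> = (\<integral>\<omega>. complex_of_real (exp (- Q / 2 * Y \<omega>)) \<partial>M)"
    by (rule integral_distr) auto
  also have "\<dots> = complex_of_real (\<integral>\<omega>. exp (- Q / 2 * Y \<omega>) \<partial>M)"
    by (rule integral_complex_of_real)
  finally show "(\<integral>\<omega>. iexp (\<Sum>k\<in>K. c k * B (\<tau> k * Y \<omega> powr (1 / \<alpha>)) \<omega>) \<partial>M)
      = (\<integral>\<omega>. exp (- (\<Sum>k\<in>K. \<Sum>j\<in>K. c k * fbm_cov \<alpha> (\<tau> k) (\<tau> j) * c j) / 2 * Y \<omega>) \<partial>M)"
    unfolding Q_def .
qed

section \<open>Generalized grey Brownian motion and the M-Wright law\<close>

lemma M_Wright_Laplace:
  assumes m: "M_Wright_density \<beta> m" and Y: "distributed M lborel Y (\<lambda>\<tau>. ennreal (m \<tau>))" and s: "0 \<le> s"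
  shows "complex_of_real (\<integral>\<omega>. exp (- s * Y \<omega>) \<partial>M) = mittag_leffler \<beta> (complex_of_real (- s))"
proof -
  have nonneg: "0 \<le> m \<tau>" for \<tau> using m by (cases "0 \<le> \<tau>") (auto simp: M_Wright_density_def)
  have "(\<integral>\<omega>. exp (- s * Y \<omega>) \<partial>M) = (\<integral>\<tau>. m \<tau> * exp (- s * \<tau>) \<partial>lborel)"
    using distributed_integral[OF Y, of "\<lambda>\<tau>. exp (- s * \<tau>)"] nonneg by simp
  also have "\<dots> = (LINT \<tau>:{0..}|lborel. exp (- s * \<tau>) * m \<tau>)"
    unfolding set_lebesgue_integral_def using m
    by (intro Bochner_Integration.integral_cong) (auto simp: M_Wright_density_def indicator_def)
  finally show ?thesis using m s by (simp add: M_Wright_density_def)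
qed

text \<open>The characteristic function of a generalized grey Brownian motion is prescribed for increasing
  enumerations of times; listing a finite set of times in increasing order gives the version
  indexed by the set itself.\<close>

lemma ggBm_char:
  assumes X: "generalized_grey_brownian_motion \<beta> \<alpha> N X" and J: "finite J" "J \<subseteq> {0..}"
  shows "(\<integral>\<omega>. iexp (\<Sum>t\<in>J. c t * X t \<omega>) \<partial>N)
    = mittag_leffler \<beta> (complex_of_real (- (1/2) * (\<Sum>t\<in>J. \<Sum>s\<in>J. c t * fbm_cov \<alpha> t s * c s)))"
proof -
  let ?n = "card J" and ?t = "\<lambda>k. sorted_list_of_set J ! (k - 1)"
  have len: "length (sorted_list_of_set J) = ?n" by simp
  have mono: "strict_mono_on {1..?n} ?t"
    by (rule strict_mono_onI) (auto intro!: sorted_wrt_nth_less[OF strict_sorted_list_of_set])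
  have img: "?t ` {1..?n} = J"
  proof -
    have "?t ` {1..?n} = (\<lambda>i. sorted_list_of_set J ! i) ` {..<?n}"
      by (simp only: image_Suc_lessThan[symmetric] image_image diff_Suc_1)
    also have "\<dots> = set (sorted_list_of_set J)"
      using nth_image[of ?n "sorted_list_of_set J"] by (simp add: lessThan_atLeast0)
    finally show ?thesis using J by simp
  qed
  have inj: "inj_on ?t {1..?n}" using mono by (rule strict_mono_on_imp_inj_on)
  have reindex: "(\<Sum>k=1..?n. g (?t k)) = (\<Sum>t\<in>J. g t)" for g :: "real \<Rightarrow> real"
    by (rule sum.reindex[OF inj, of g, unfolded img o_def, symmetric])
  have nonneg: "\<forall>k\<in>{1..?n}. 0 \<le> ?t k" using img J(2) by auto
  have char: "(\<integral>\<omega>. iexp (\<Sum>k=1..n. \<theta> k * X (t k) \<omega>) \<partial>N)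
      = mittag_leffler \<beta> (complex_of_real
          (- (1/2) * (\<Sum>k=1..n. \<Sum>j=1..n. \<theta> k * fbm_cov \<alpha> (t k) (t j) * \<theta> j)))"
    if "\<forall>k\<in>{1..n}. 0 \<le> t k" "strict_mono_on {1..n} t" for n :: nat and t \<theta>
    using X that unfolding generalized_grey_brownian_motion_def by simp
  have "(\<Sum>t\<in>J. c t * X t \<omega>) = (\<Sum>k=1..?n. c (?t k) * X (?t k) \<omega>)" for \<omega>
    by (rule reindex[symmetric])
  moreover have "(\<Sum>t\<in>J. \<Sum>s\<in>J. c t * fbm_cov \<alpha> t s * c s)
      = (\<Sum>k=1..?n. \<Sum>j=1..?n. c (?t k) * fbm_cov \<alpha> (?t k) (?t j) * c (?t j))"
  proof -
    have "(\<Sum>t\<in>J. \<Sum>s\<in>J. c t * fbm_cov \<alpha> t s * c s)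
        = (\<Sum>k=1..?n. \<Sum>s\<in>J. c (?t k) * fbm_cov \<alpha> (?t k) s * c s)"
      by (rule reindex[symmetric])
    also have "\<dots> = (\<Sum>k=1..?n. \<Sum>j=1..?n. c (?t k) * fbm_cov \<alpha> (?t k) (?t j) * c (?t j))"
      by (intro sum.cong refl reindex[symmetric])
    finally show ?thesis .
  qed
  ultimately show ?thesis
    using char[OF nonneg mono, of "\<lambda>k. c (?t k)"] by (simp only:)
qed

theorem proposition2p14:
  fixes \<beta> \<alpha> :: real
    and N :: "'b measure" and X :: "real \<Rightarrow> 'b \<Rightarrow> real"
    and M :: "'a measure" and B :: "real \<Rightarrow> 'a \<Rightarrow> real"
    and Y :: "'a \<Rightarrow> real" and m :: "real \<Rightarrow> real"
  assumes "0 < \<beta>" and "\<beta> < 1" and "1 \<le> \<alpha>" and "\<alpha> < 2"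
    and "generalized_grey_brownian_motion \<beta> \<alpha> N X"
    and "fractional_brownian_motion (\<alpha> / 2) M B"
    and "\<forall>\<omega>\<in>space M. 0 \<le> Y \<omega>"
    and "M_Wright_density \<beta> m"
    and "distributed M lborel Y (\<lambda>\<tau>. ennreal (m \<tau>))"
    and "process_indep_var M B Y"
  shows "equal_in_law N X M (\<lambda>t \<omega>. B (t * Y \<omega> powr (1 / \<alpha>)) \<omega>)"
proof -
  have \<alpha>: "0 < \<alpha>" using assms(3) by simp
  have Y: "Y \<in> borel_measurable M" using distributed_measurable[OF assms(9)] by simp
  note Z = time_changed_fbm[OF \<alpha> assms(6) Y assms(7,10)]
  have X_proc: "real_process N X"
    using assms(5) by (simp add: generalized_grey_brownian_motion_def continuous_process_def)
  have Z_proc: "real_process M (\<lambda>t \<omega>. B (t * Y \<omega> powr (1 / \<alpha>)) \<omega>)"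
    using assms(6) Z(1) by (simp add: fractional_brownian_motion_def continuous_process_def real_process_def)
  show ?thesis unfolding equal_in_law_def
  proof (intro conjI X_proc Z_proc allI impI)
    fix J :: "real set" assume J: "finite J" "J \<subseteq> {0..}"
    show "distr N (\<Pi>\<^sub>M t\<in>J. borel) (\<lambda>\<omega>. \<lambda>t\<in>J. X t \<omega>)
        = distr M (\<Pi>\<^sub>M t\<in>J. borel) (\<lambda>\<omega>. \<lambda>t\<in>J. B (t * Y \<omega> powr (1 / \<alpha>)) \<omega>)"
    proof (rule process_char_eq_imp_distr_eq[OF _ _ J(1)])
      fix c :: "real \<Rightarrow> real"
      let ?Q = "\<Sum>t\<in>J. \<Sum>s\<in>J. c t * fbm_cov \<alpha> t s * c s"
      have pos: "0 \<le> t" if "t \<in> J" for t using that J(2) by auto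
      have Q: "0 \<le> ?Q" using fbm_char(2)[OF assms(6) J(1), of "\<lambda>t. t" c] pos by simp
      have "(\<integral>\<omega>. iexp (\<Sum>t\<in>J. c t * X t \<omega>) \<partial>N) = mittag_leffler \<beta> (complex_of_real (- (?Q / 2)))"
        using ggBm_char[OF assms(5) J, of c] by simp
      also have "\<dots> = complex_of_real (\<integral>\<omega>. exp (- (?Q / 2) * Y \<omega>) \<partial>M)"
        using M_Wright_Laplace[OF assms(8,9), of "?Q / 2"] Q by simp
      also have "\<dots> = (\<integral>\<omega>. iexp (\<Sum>t\<in>J. c t * B (t * Y \<omega> powr (1 / \<alpha>)) \<omega>) \<partial>M)"
        using Z(2)[OF J(1), of "\<lambda>t. t" c] pos by simp
      finally show "(\<integral>\<omega>. iexp (\<Sum>t\<in>J. c t * X t \<omega>) \<partial>N)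
        = (\<integral>\<omega>. iexp (\<Sum>t\<in>J. c t * B (t * Y \<omega> powr (1 / \<alpha>)) \<omega>) \<partial>M)" .
    qed (use X_proc Z_proc J(2) in \<open>auto simp: real_process_def\<close>)
  qed
qed

end
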